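(* Let $E,F$ be locally convex spaces, $U$ an open neighborhood of $0$ in $E$, and $f:U\to F$ a function. Suppose $f$ is uniformly continuous and $U$ is convex. Then $f$ is a finite function.
   Context: We work in a sufficiently saturated nonstandard extension; $A^*$ is the nonstandard extension of $A$, and the extension of a function is denoted by the same symbol. A locally convex space is a real Hausdorff topological vector space with a base of convex neighborhoods of $0$. $E_f=\{x\in E^* : p(x)$ is a finite hyperreal for all continuous seminorms $p$ on $E\}$, and similarly $F_f$. $f:U\to F$ is a finite function if $f(U^*\cap E_f)\subseteq F_f$. *)

theory Defs
  imports "HOL-Analysis.Analysis"
begin

unbundle cardinal_syntax

section \<open>Locally convex spaces\<close>

text \<open>
  The class \<^class>\<open>uniform_topological_group_add\<close> supplies the topology together with a compatible
  uniformity for which addition and negation are uniformly continuous. In a topological vector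
  space this is the usual translation-invariant uniformity; see
  \<open>eventually_uniformity_iff_nhds_0\<close> below.
\<close>

class locally_convex_space = real_vector + uniform_topological_group_add + t2_space +
  assumes tendsto_scaleR_Pair:
      "LIM z (nhds r \<times>\<^sub>F nhds x). fst z *\<^sub>R snd z :> nhds (r *\<^sub>R x)"
    and convex_nhds_base:
      "open V \<Longrightarrow> 0 \<in> V \<Longrightarrow> \<exists>W C. open W \<and> 0 \<in> W \<and> W \<subseteq> C \<and> C \<subseteq> V \<and>
         (\<forall>x\<in>C. \<forall>y\<in>C. \<forall>u\<ge>0. \<forall>v\<ge>0. u + v = 1 \<longrightarrow> u *\<^sub>R x + v *\<^sub>R y \<in> C)"
  \<comment> \<open>\<open>C\<close> is convex; the constant \<^const>\<open>convex\<close> is not available in a class specification\<close>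

lemma locally_convex_nhds_base:
  fixes V :: "'a::locally_convex_space set"
  assumes "open V" "0 \<in> V"
  shows "\<exists>W C. open W \<and> 0 \<in> W \<and> W \<subseteq> C \<and> C \<subseteq> V \<and> convex C"
  using convex_nhds_base[OF assms] unfolding convex_def by blast

lemma continuous_on_scaleR_locally_convex_space:
  "continuous_on UNIV (\<lambda>(r, x :: 'a::locally_convex_space). r *\<^sub>R x)"
proof -
  have "((\<lambda>(r, x :: 'a). r *\<^sub>R x) \<longlongrightarrow> (case z of (r, x) \<Rightarrow> r *\<^sub>R x)) (at z)" for z
    using tendsto_scaleR_Pair[of "fst z" "snd z"]
    by (auto simp: case_prod_unfold nhds_prod[symmetric] at_within_def intro: tendsto_mono[OF inf_le1])
  then show ?thesis
    by (simp add: continuous_on_def)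
qed

lemma eventually_uniformity_iff_nhds_0:
  fixes P :: "'a::{uniform_topological_group_add, ab_group_add} \<times> 'a \<Rightarrow> bool"
  shows "eventually P uniformity \<longleftrightarrow> (\<exists>V. open V \<and> 0 \<in> V \<and> (\<forall>x y. y - x \<in> V \<longrightarrow> P (x, y)))"
proof
  assume P: "eventually P uniformity"
  have "filterlim (\<lambda>((a::'a,b), (c,d)). (a + c, b + d)) uniformity (uniformity \<times>\<^sub>F uniformity)"
    by (rule uniformly_continuous_add')
  then obtain Q where Q: "eventually Q uniformity" "\<And>a b c. Q (a, b) \<Longrightarrow> P (a + c, b + c)"
    using P by (rule uniformity_of_uniform_continuous_invariant) blast
  have "eventually (\<lambda>y. Q (0, y)) (nhds 0)"
    unfolding eventually_nhds_uniformity using Q(1) by (rule eventually_mono) auto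
  then obtain V where V: "open V" "0 \<in> V" "\<And>y. y \<in> V \<Longrightarrow> Q (0, y)"
    by (auto simp: eventually_nhds)
  have "P (x, y)" if "y - x \<in> V" for x y
    using Q(2)[of 0 "y - x" x] V(3)[OF that] by simp
  with V show "\<exists>V. open V \<and> 0 \<in> V \<and> (\<forall>x y. y - x \<in> V \<longrightarrow> P (x, y))" by blast
next
  assume "\<exists>V. open V \<and> 0 \<in> V \<and> (\<forall>x y. y - x \<in> V \<longrightarrow> P (x, y))"
  then obtain V where V: "open V" "0 \<in> V" "\<And>x y. y - x \<in> V \<Longrightarrow> P (x, y)" by blast
  have D: "eventually (\<lambda>(x', y). x' = 0 \<longrightarrow> y \<in> V) uniformity"
    using V(1,2) by (auto simp: open_uniformity)
  have "filterlim (\<lambda>((a::'a,b), (c,d)). (a - c, b - d)) uniformity (uniformity \<times>\<^sub>F uniformity)"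
    by (rule uniformly_continuous_minus')
  then obtain Q where Q: "eventually Q uniformity"
    "\<And>a b c. Q (a, b) \<Longrightarrow> (case (a - c, b - c) of (x', y) \<Rightarrow> x' = 0 \<longrightarrow> y \<in> V)"
    using D by (rule uniformity_of_uniform_continuous_invariant) blast
  show "eventually P uniformity"
    using Q(1)
  proof (rule eventually_mono)
    fix z assume "Q z"
    then show "P z" using Q(2)[of "fst z" "snd z" "fst z"] V(3)[of "snd z" "fst z"] by simp
  qed
qed

definition seminorm :: "('a::real_vector \<Rightarrow> real) \<Rightarrow> bool" where
  "seminorm p \<longleftrightarrow> (\<forall>x y. p (x + y) \<le> p x + p y) \<and> (\<forall>r x. p (r *\<^sub>R x) = \<bar>r\<bar> * p x)"


section \<open>Nonstandard extensions\<close>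

text \<open>
  The standard universe is a type \<open>'u\<close> into which all standard objects under consideration are
  injected, and its nonstandard extension is a type \<open>'v\<close>; think of \<open>'u\<close> as a set in the
  superstructure over \<open>E\<close>, \<open>F\<close> and the reals, and of \<open>'v\<close> as its star. A standard \<open>n\<close>-ary
  relation is a set of lists of length \<open>n\<close>; \<open>ext R\<close> is its nonstandard extension, and \<open>star a\<close>
  that of an element \<open>a\<close>. The formulas below are the first-order formulas
  (with variables numbered by naturals) having a symbol for every standard relation.
\<close>

datatype 'u formula =
    Rel "'u list set" "nat list"
  | Equal nat nat
  | Neg "'u formula"
  | Conj "'u formula" "'u formula"
  | Forall nat "'u formula"

primrec holds :: "('u list set \<Rightarrow> 'a list set) \<Rightarrow> (nat \<Rightarrow> 'a) \<Rightarrow> 'u formula \<Rightarrow> bool" where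
  "holds I s (Rel R xs) \<longleftrightarrow> map s xs \<in> I R"
| "holds I s (Equal x y) \<longleftrightarrow> s x = s y"
| "holds I s (Neg \<phi>) \<longleftrightarrow> \<not> holds I s \<phi>"
| "holds I s (Conj \<phi> \<psi>) \<longleftrightarrow> holds I s \<phi> \<and> holds I s \<psi>"
| "holds I s (Forall x \<phi>) \<longleftrightarrow> (\<forall>a. holds I (s(x := a)) \<phi>)"

text \<open>The transfer principle. The valuation \<open>s\<close> supplies standard parameters.\<close>

definition nonstandard_extension ::
    "('u \<Rightarrow> 'v) \<Rightarrow> ('u list set \<Rightarrow> 'v list set) \<Rightarrow> bool" where
  "nonstandard_extension star ext \<longleftrightarrow>
     (\<forall>\<phi> s. holds (\<lambda>R. R) s \<phi> \<longleftrightarrow> holds ext (star \<circ> s) \<phi>)"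

text \<open>
  The internal subsets of \<open>'v\<close> are the sections of extended standard relations by parameters
  from \<open>'v\<close>. (When \<open>'u\<close> contains the power set of \<open>X\<close>, every element \<open>B\<close> of its star defines
  the section at \<open>B\<close> of the extended membership relation, so all internal subsets of the star of
  \<open>X\<close> arise in this way.)
\<close>

definition internal :: "('u list set \<Rightarrow> 'v list set) \<Rightarrow> 'v set \<Rightarrow> bool" where
  "internal ext A \<longleftrightarrow> (\<exists>R bs. A = {y. y # bs \<in> ext R})"

definition saturated :: "'k rel \<Rightarrow> ('u list set \<Rightarrow> 'v list set) \<Rightarrow> bool" where
  "saturated \<kappa> ext \<longleftrightarrow>
     (\<forall>\<A>. (\<forall>A\<in>\<A>. internal ext A) \<and> |\<A>| <o \<kappa> \<and>
        (\<forall>\<B>. \<B> \<subseteq> \<A> \<and> finite \<B> \<longrightarrow> \<Inter>\<B> \<noteq> {}) \<longrightarrow> \<Inter>\<A> \<noteq> {})"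

text \<open>
  Extensions of a set \<open>A\<close> and of a function \<open>f\<close> with domain \<open>A\<close>, where \<open>i\<close> and \<open>j\<close> are the
  injections of the types involved into the standard universe. By transfer, the extended graph
  of \<open>f\<close> is the graph of a function on the extension of \<open>A\<close>, so \<open>THE\<close> is well defined there.
\<close>

definition ext_set :: "('u list set \<Rightarrow> 'v list set) \<Rightarrow> ('a \<Rightarrow> 'u) \<Rightarrow> 'a set \<Rightarrow> 'v set" where
  "ext_set ext i A = {v. [v] \<in> ext {[i a] | a. a \<in> A}}"

definition ext_fun ::
    "('u list set \<Rightarrow> 'v list set) \<Rightarrow> ('a \<Rightarrow> 'u) \<Rightarrow> ('b \<Rightarrow> 'u) \<Rightarrow> 'a set \<Rightarrow> ('a \<Rightarrow> 'b) \<Rightarrow> 'v \<Rightarrow> 'v" where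
  "ext_fun ext i j A f v = (THE w. [v, w] \<in> ext {[i a, j (f a)] | a. a \<in> A})"

definition ext_le :: "('u list set \<Rightarrow> 'v list set) \<Rightarrow> (real \<Rightarrow> 'u) \<Rightarrow> 'v \<Rightarrow> 'v \<Rightarrow> bool" where
  "ext_le ext iR v w \<longleftrightarrow> [v, w] \<in> ext {[iR a, iR b] | a b. a \<le> b}"

definition finite_hyperreal ::
    "('u \<Rightarrow> 'v) \<Rightarrow> ('u list set \<Rightarrow> 'v list set) \<Rightarrow> (real \<Rightarrow> 'u) \<Rightarrow> 'v \<Rightarrow> bool" where
  "finite_hyperreal star ext iR h \<longleftrightarrow> h \<in> ext_set ext iR UNIV \<and>
     (\<exists>n::nat. ext_le ext iR (ext_fun ext iR iR UNIV abs h) (star (iR (real n))))"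

definition finite_points ::
    "('u \<Rightarrow> 'v) \<Rightarrow> ('u list set \<Rightarrow> 'v list set) \<Rightarrow> (real \<Rightarrow> 'u) \<Rightarrow>
     ('a::locally_convex_space \<Rightarrow> 'u) \<Rightarrow> 'v set" where
  "finite_points star ext iR i =
     {x \<in> ext_set ext i UNIV. \<forall>p. seminorm p \<and> continuous_on UNIV p \<longrightarrow>
        finite_hyperreal star ext iR (ext_fun ext i iR UNIV p x)}"

definition finite_function ::
    "('u \<Rightarrow> 'v) \<Rightarrow> ('u list set \<Rightarrow> 'v list set) \<Rightarrow> (real \<Rightarrow> 'u) \<Rightarrow>
     ('a::locally_convex_space \<Rightarrow> 'u) \<Rightarrow> ('b::locally_convex_space \<Rightarrow> 'u) \<Rightarrow>
     'a set \<Rightarrow> ('a \<Rightarrow> 'b) \<Rightarrow> bool" where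
  "finite_function star ext iR iE iF U f \<longleftrightarrow>
     ext_fun ext iE iF U f ` (ext_set ext iE U \<inter> finite_points star ext iR iE)
       \<subseteq> finite_points star ext iR iF"

end

theory Submission
  imports Defs
begin

text \<open>
  The nonstandard statement follows from a standard inequality. Let \<open>q\<close> be a continuous seminorm
  on \<open>F\<close>. Uniform continuity gives a neighborhood \<open>V\<close> of \<open>0\<close> such that \<open>q (f y - f x) < 1\<close>
  whenever \<open>x\<close> and \<open>y\<close> are in \<open>U\<close> and \<open>y - x\<close> is in \<open>V\<close>, and local convexity gives a continuous
  seminorm \<open>p\<close> whose open unit ball lies in \<open>V\<close>: the Minkowski gauge of a symmetric convex
  neighborhood inside \<open>V\<close> (\<open>continuous_seminorm_inside_nhd\<close>). For \<open>x\<close> in \<open>U\<close> cut the segment from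
  \<open>0\<close> to \<open>x\<close>, which stays in the convex set \<open>U\<close>, into \<open>n\<close> equal pieces with
  \<open>p x < n \<le> p x + 1\<close>. Each piece is shorter than \<open>1\<close> for \<open>p\<close>, so \<open>q \<circ> f\<close> grows by less than \<open>1\<close>
  along it, whence \<open>q (f x) \<le> p x + (q (f 0) + 1)\<close>
  (\<open>uniformly_continuous_on_convex_linear_growth\<close>).

  To transfer this inequality, finiteness is first expressed by standard sets alone:
  \<open>p v\<close> is finite if and only if \<open>v\<close> lies in the extension of \<open>{a. \<bar>p a\<bar> \<le> n}\<close> for some standard
  \<open>n\<close> (\<open>finite_hyperreal_ext_fun_iff\<close>). The inequality puts \<open>U \<inter> {a. \<bar>p a\<bar> \<le> n}\<close> inside
  \<open>{a \<in> U. \<bar>q (f a)\<bar> \<le> m}\<close> for a standard \<open>m\<close>, and extension preserves inclusions, intersections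
  and preimages, by transfer of explicit formulas.
\<close>

section \<open>Extensions of sets and functions\<close>

lemma transfer:
  assumes "nonstandard_extension star ext" "holds (\<lambda>R. R) s \<phi>"
  shows "holds ext (star \<circ> s) \<phi>"
  using assms unfolding nonstandard_extension_def by blast

lemma ext_set_mono:
  assumes ne: "nonstandard_extension star ext" and "A \<subseteq> B"
  shows "ext_set ext i A \<subseteq> ext_set ext i B"
proof -
  have "holds (\<lambda>R. R) (\<lambda>_. undefined) (Forall 0 (Neg (Conj (Rel {[i a] |a. a \<in> A} [0])
      (Neg (Rel {[i a] |a. a \<in> B} [0])))))"
    using \<open>A \<subseteq> B\<close> by auto
  from transfer[OF ne this] show ?thesis
    unfolding ext_set_def by auto
qed

lemma ext_set_Int:
  assumes ne: "nonstandard_extension star ext" and "inj i"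
  shows "ext_set ext i A \<inter> ext_set ext i B \<subseteq> ext_set ext i (A \<inter> B)"
proof -
  have "holds (\<lambda>R. R) (\<lambda>_. undefined) (Forall 0 (Neg (Conj (Conj (Rel {[i a] |a. a \<in> A} [0])
      (Rel {[i a] |a. a \<in> B} [0])) (Neg (Rel {[i a] |a. a \<in> A \<inter> B} [0])))))"
    using injD[OF \<open>inj i\<close>] by auto
  from transfer[OF ne this] show ?thesis
    unfolding ext_set_def by auto
qed

text \<open>
  Transfer of totality and of single-valuedness of the graph of \<open>f\<close> over \<open>A\<close>. This is what gives
  the description operator in \<^const>\<open>ext_fun\<close> a meaning, and every later fact about
  \<^const>\<open>ext_fun\<close> rests on it. Injectivity of \<open>i\<close> is needed for the coded graph to be single-valued.
\<close>

lemma ext_fun_graph: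
  assumes ne: "nonstandard_extension star ext" and "inj i" and v: "v \<in> ext_set ext i A"
  shows "[v, ext_fun ext i j A f v] \<in> ext {[i a, j (f a)] |a. a \<in> A}"
proof -
  let ?G = "{[i a, j (f a)] |a. a \<in> A}"
  have "holds (\<lambda>R. R) (\<lambda>_. undefined) (Forall 0 (Neg (Conj (Rel {[i a] |a. a \<in> A} [0])
      (Forall 1 (Neg (Rel ?G [0, 1]))))))"
    by auto
  from transfer[OF ne this] v have ex: "\<exists>w. [v, w] \<in> ext ?G"
    unfolding ext_set_def by auto
  have "holds (\<lambda>R. R) (\<lambda>_. undefined) (Forall 0 (Forall 1 (Forall 2
      (Neg (Conj (Conj (Rel ?G [0, 1]) (Rel ?G [0, 2])) (Neg (Equal 1 2)))))))"
    using injD[OF \<open>inj i\<close>] by auto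
  from transfer[OF ne this] have "w = w'" if "[v, w] \<in> ext ?G" "[v, w'] \<in> ext ?G" for w w'
    using that by auto
  with ex have "\<exists>!w. [v, w] \<in> ext ?G" by blast
  from theI'[OF this] show ?thesis
    unfolding ext_fun_def .
qed

text \<open>
  Extension commutes with preimages. Each direction transfers one universal sentence about the
  graph of \<open>f\<close>. Iterating the rule computes preimages under composites without ever extending a
  composite function.
\<close>

lemma ext_fun_in_ext_set_iff:
  assumes ne: "nonstandard_extension star ext" and "inj i" "inj j" and v: "v \<in> ext_set ext i A"
  shows "ext_fun ext i j A f v \<in> ext_set ext j B \<longleftrightarrow> v \<in> ext_set ext i {a \<in> A. f a \<in> B}"
proof -
  let ?G = "{[i a, j (f a)] |a. a \<in> A}"
  let ?P = "{[i a] |a. a \<in> {a \<in> A. f a \<in> B}}" and ?B = "{[j b] |b. b \<in> B}"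
  have "holds (\<lambda>R. R) (\<lambda>_. undefined) (Forall 0 (Forall 1
      (Neg (Conj (Conj (Rel ?G [0, 1]) (Rel ?P [0])) (Neg (Rel ?B [1]))))))"
    using injD[OF \<open>inj i\<close>] by auto
  note 1 = transfer[OF ne this]
  have "holds (\<lambda>R. R) (\<lambda>_. undefined) (Forall 0 (Forall 1
      (Neg (Conj (Conj (Rel ?G [0, 1]) (Rel ?B [1])) (Neg (Rel ?P [0]))))))"
    using injD[OF \<open>inj j\<close>] by auto
  note 2 = transfer[OF ne this]
  show ?thesis
    using 1 2 ext_fun_graph[OF ne \<open>inj i\<close> v, of j f] unfolding ext_set_def by auto
qed

text \<open>
  The variable \<open>1\<close> stays free in both formulas: the valuation sends it to the standard parameter
  \<open>iR r\<close>, hence to \<open>star (iR r)\<close> after transfer.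
\<close>

lemma ext_le_star_iff:
  assumes ne: "nonstandard_extension star ext" and "inj iR"
  shows "ext_le ext iR h (star (iR r)) \<longleftrightarrow> h \<in> ext_set ext iR {..r}"
proof -
  let ?L = "{[iR a, iR b] |a b. a \<le> b}" and ?B = "{[iR a] |a. a \<in> {..r}}"
  have "holds (\<lambda>R. R) (\<lambda>_. iR r) (Forall 0 (Neg (Conj (Rel ?L [0, 1]) (Neg (Rel ?B [0])))))"
    using injD[OF \<open>inj iR\<close>] by auto
  note 1 = transfer[OF ne this]
  have "holds (\<lambda>R. R) (\<lambda>_. iR r) (Forall 0 (Neg (Conj (Rel ?B [0]) (Neg (Rel ?L [0, 1])))))"
    using injD[OF \<open>inj iR\<close>] by auto
  note 2 = transfer[OF ne this]
  show ?thesis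
    using 1 2 unfolding ext_set_def ext_le_def by auto
qed

text \<open>
  Pulling \<open>{..n}\<close> back through the absolute value and then through \<open>p\<close> removes the hyperreals from
  the notion of finiteness: only extensions of standard subsets of the domain of \<open>p\<close> remain.
\<close>

lemma finite_hyperreal_ext_fun_iff:
  assumes ne: "nonstandard_extension star ext" and "inj i" "inj iR" and v: "v \<in> ext_set ext i UNIV"
  shows "finite_hyperreal star ext iR (ext_fun ext i iR UNIV p v) \<longleftrightarrow>
    (\<exists>n::nat. v \<in> ext_set ext i {a. \<bar>p a\<bar> \<le> real n})"
proof -
  have R: "ext_fun ext i iR UNIV p v \<in> ext_set ext iR UNIV"
    using ext_fun_in_ext_set_iff[OF ne \<open>inj i\<close> \<open>inj iR\<close> v, of p UNIV] v by simp
  show ?thesis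
    unfolding finite_hyperreal_def ext_le_star_iff[OF ne \<open>inj iR\<close>]
      ext_fun_in_ext_set_iff[OF ne \<open>inj iR\<close> \<open>inj iR\<close> R]
      ext_fun_in_ext_set_iff[OF ne \<open>inj i\<close> \<open>inj iR\<close> v]
    using v by simp
qed

section \<open>Gauges of convex neighborhoods\<close>

lemma seminorm_zero:
  assumes "seminorm p" shows "p 0 = 0"
proof -
  have "p (0 *\<^sub>R 0) = \<bar>0\<bar> * p 0" using assms unfolding seminorm_def by blast
  then show ?thesis by simp
qed

lemma seminorm_minus:
  assumes "seminorm p" shows "p (- x) = p x"
proof -
  have "p ((-1) *\<^sub>R x) = \<bar>-1\<bar> * p x" using assms unfolding seminorm_def by blast
  then show ?thesis by simp
qed

lemma seminorm_nonneg:
  assumes "seminorm p" shows "0 \<le> p x"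
proof -
  have "p (x + - x) \<le> p x + p (- x)" using assms unfolding seminorm_def by blast
  then show ?thesis by (simp add: seminorm_zero[OF assms] seminorm_minus[OF assms])
qed

lemma continuous_on_scaleR_const_left:
  "continuous_on UNIV (\<lambda>x :: 'a::locally_convex_space. r *\<^sub>R x)"
  using continuous_on_compose2[OF continuous_on_scaleR_locally_convex_space,
      of UNIV "\<lambda>x. (r, x)"] by (simp add: continuous_on_Pair)

lemma continuous_on_scaleR_const_right:
  "continuous_on UNIV (\<lambda>r. r *\<^sub>R (x :: 'a::locally_convex_space))"
  using continuous_on_compose2[OF continuous_on_scaleR_locally_convex_space,
      of UNIV "\<lambda>r. (r, x)"] by (simp add: continuous_on_Pair)

text \<open>
  The Minkowski functional of \<open>D\<close>. The infimum is meaningful when \<open>D\<close> is absorbing, since the set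
  of admissible \<open>t\<close> is then nonempty; it is always bounded below by \<open>0\<close>.
\<close>

definition gauge_of :: "'a::real_vector set \<Rightarrow> 'a \<Rightarrow> real" where
  "gauge_of D x = Inf {t. 0 < t \<and> (1 / t) *\<^sub>R x \<in> D}"

lemma gauge_of_le:
  assumes "0 < t" "(1 / t) *\<^sub>R x \<in> D"
  shows "gauge_of D x \<le> t"
  unfolding gauge_of_def
  by (rule cInf_lower) (use assms in \<open>auto intro!: bdd_belowI[where m=0]\<close>)

text \<open>
  The admissible \<open>t\<close> form an up-closed set: if \<open>t < s\<close>, then \<open>(1 / s) *\<^sub>R x\<close> lies on the segment
  from \<open>0\<close> to \<open>(1 / t) *\<^sub>R x\<close>, and \<open>D\<close> is convex.
\<close>

lemma gauge_of_less_imp: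
  assumes "convex D" "0 \<in> D" "gauge_of D x < s" "\<exists>t>0. (1 / t) *\<^sub>R x \<in> D"
  shows "0 < s \<and> (1 / s) *\<^sub>R x \<in> D"
proof -
  obtain t where t: "0 < t" "(1 / t) *\<^sub>R x \<in> D" "t < s"
    using assms(3,4) cInf_lessD[of "{t. 0 < t \<and> (1 / t) *\<^sub>R x \<in> D}" s]
    unfolding gauge_of_def by blast
  have "(1 - t / s) *\<^sub>R 0 + (t / s) *\<^sub>R ((1 / t) *\<^sub>R x) \<in> D"
    by (rule convexD[OF assms(1,2) t(2)]) (use t in auto)
  with t show ?thesis by simp
qed

text \<open>
  Subadditivity is convexity of \<open>D\<close>: if \<open>x\<close> is in \<open>s D\<close> and \<open>y\<close> is in \<open>t D\<close>, then \<open>(x + y) / (s + t)\<close>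
  is the convex combination of \<open>x / s\<close> and \<open>y / t\<close> with weights \<open>s / (s + t)\<close> and \<open>t / (s + t)\<close>.
  For homogeneity, symmetry of \<open>D\<close> absorbs the sign of the scalar.
\<close>

lemma seminorm_gauge_of:
  assumes D: "convex D" "0 \<in> D" and sym: "\<And>x. x \<in> D \<Longrightarrow> - x \<in> D"
    and absorbing: "\<And>x. \<exists>t>0. (1 / t) *\<^sub>R x \<in> D"
  shows "seminorm (gauge_of D)"
proof -
  note less_imp = gauge_of_less_imp[OF D _ absorbing]
  have add: "gauge_of D (x + y) \<le> gauge_of D x + gauge_of D y" for x y
  proof (rule field_le_epsilon)
    fix e :: real assume "0 < e"
    define s t where "s = gauge_of D x + e / 2" and "t = gauge_of D y + e / 2"
    have s: "0 < s" "(1 / s) *\<^sub>R x \<in> D" and t: "0 < t" "(1 / t) *\<^sub>R y \<in> D"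
      using less_imp[of x s] less_imp[of y t] \<open>0 < e\<close> by (auto simp: s_def t_def)
    have "(s / (s + t)) *\<^sub>R ((1 / s) *\<^sub>R x) + (t / (s + t)) *\<^sub>R ((1 / t) *\<^sub>R y) \<in> D"
      by (rule convexD[OF D(1) s(2) t(2)]) (use s t in \<open>auto simp: add_divide_distrib[symmetric]\<close>)
    then have "(1 / (s + t)) *\<^sub>R (x + y) \<in> D"
      using s t by (simp add: scaleR_add_right)
    then have "gauge_of D (x + y) \<le> s + t"
      using s t by (intro gauge_of_le) auto
    then show "gauge_of D (x + y) \<le> gauge_of D x + gauge_of D y + e"
      by (simp add: s_def t_def)
  qed
  have nonneg: "0 \<le> gauge_of D x" for x
    unfolding gauge_of_def by (rule cInf_greatest) (use absorbing in auto)
  have scale_le: "gauge_of D (r *\<^sub>R x) \<le> \<bar>r\<bar> * gauge_of D x" if "r \<noteq> 0" for r x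
  proof (rule field_le_epsilon)
    fix e :: real assume "0 < e"
    define s where "s = gauge_of D x + e / \<bar>r\<bar>"
    have s: "0 < s" "(1 / s) *\<^sub>R x \<in> D"
      using less_imp[of x s] \<open>0 < e\<close> that by (auto simp: s_def)
    have "(1 / (\<bar>r\<bar> * s)) *\<^sub>R (r *\<^sub>R x) = (1 / s) *\<^sub>R x \<or>
      (1 / (\<bar>r\<bar> * s)) *\<^sub>R (r *\<^sub>R x) = - ((1 / s) *\<^sub>R x)"
      using that by (cases "r > 0") auto
    then have "(1 / (\<bar>r\<bar> * s)) *\<^sub>R (r *\<^sub>R x) \<in> D"
      using s(2) sym[OF s(2)] by metis
    then have "gauge_of D (r *\<^sub>R x) \<le> \<bar>r\<bar> * s"
      using s that by (intro gauge_of_le) auto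
    also have "\<dots> = \<bar>r\<bar> * gauge_of D x + e"
      using that by (simp add: s_def distrib_left)
    finally show "gauge_of D (r *\<^sub>R x) \<le> \<bar>r\<bar> * gauge_of D x + e" .
  qed
  have zero: "gauge_of D 0 = 0"
  proof (rule antisym[OF field_le_epsilon nonneg])
    fix e :: real assume "0 < e"
    then show "gauge_of D 0 \<le> 0 + e" using D(2) by (auto intro: gauge_of_le)
  qed
  have "gauge_of D (r *\<^sub>R x) = \<bar>r\<bar> * gauge_of D x" for r x
  proof (cases "r = 0")
    case False
    \<comment> \<open>The reverse inequality is \<open>scale_le\<close> applied to the scalar \<open>1 / r\<close> and the vector \<open>r *\<^sub>R x\<close>.\<close>
    have "\<bar>r\<bar> * gauge_of D ((1 / r) *\<^sub>R (r *\<^sub>R x)) \<le> \<bar>r\<bar> * (\<bar>1 / r\<bar> * gauge_of D (r *\<^sub>R x))"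
      using False by (intro mult_left_mono scale_le) auto
    with False have "\<bar>r\<bar> * gauge_of D x \<le> gauge_of D (r *\<^sub>R x)"
      by (simp add: abs_divide)
    with scale_le[OF False] show ?thesis by (rule antisym)
  qed (simp add: zero)
  with add show ?thesis unfolding seminorm_def by blast
qed

text \<open>
  By the triangle inequality \<open>\<bar>p y - p x\<bar> \<le> p (y - x)\<close>, so continuity at \<open>0\<close> suffices, and by
  homogeneity so does a bound on a single neighborhood of \<open>0\<close>. Scaling by \<open>2 / e\<close> instead of
  \<open>1 / e\<close> turns the weak bound \<open>p x \<le> 1\<close> into the strict inequality that continuity asks for.
\<close>

lemma continuous_seminorm:
  fixes p :: "'a::locally_convex_space \<Rightarrow> real"
  assumes p: "seminorm p" and W: "open W" "0 \<in> W" "\<And>x. x \<in> W \<Longrightarrow> p x \<le> 1"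
  shows "continuous_on UNIV p"
proof -
  have "(p \<longlongrightarrow> p x) (at x)" for x
  proof (rule tendstoI)
    fix e :: real assume "0 < e"
    let ?S = "(\<lambda>y. (2 / e) *\<^sub>R (y - x)) -` W"
    have "continuous_on UNIV (\<lambda>y. (2 / e) *\<^sub>R (y - x))"
      by (intro continuous_on_compose2[OF continuous_on_scaleR_const_left] continuous_intros) auto
    then have "open ?S" using \<open>open W\<close> by (simp add: open_vimage)
    moreover have "x \<in> ?S" using \<open>0 \<in> W\<close> by simp
    moreover have "dist (p y) (p x) < e" if "y \<in> ?S" for y
    proof -
      have "p ((2 / e) *\<^sub>R (y - x)) \<le> 1" using W(3) that by blast
      then have "\<bar>2 / e\<bar> * p (y - x) \<le> 1" using p unfolding seminorm_def by metis
      then have le: "p (y - x) < e" using \<open>0 < e\<close> by (simp add: field_simps)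
      have "p (x + (y - x)) \<le> p x + p (y - x)" "p (y + - (y - x)) \<le> p y + p (- (y - x))"
        using p unfolding seminorm_def by blast+
      with le show ?thesis
        unfolding seminorm_minus[OF p] by (simp add: dist_real_def abs_less_iff)
    qed
    ultimately show "\<forall>\<^sub>F y in at x. dist (p y) (p x) < e"
      unfolding eventually_at_topological by blast
  qed
  then show ?thesis by (simp add: continuous_on_def)
qed

text \<open>
  The gauge is taken of \<open>D = C \<inter> - C\<close>, where \<open>C\<close> is a convex neighborhood of \<open>0\<close> inside \<open>V\<close>; the
  intersection makes it symmetric. Such a \<open>D\<close> is absorbing because \<open>r *\<^sub>R x\<close> tends to \<open>0\<close> with \<open>r\<close>.
\<close>

lemma continuous_seminorm_inside_nhd:
  fixes V :: "'a::locally_convex_space set"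
  assumes "open V" "0 \<in> V"
  obtains p where "seminorm p" "continuous_on UNIV p" "\<And>x. p x < 1 \<Longrightarrow> x \<in> V"
proof -
  obtain W C where W: "open W" "0 \<in> W" "W \<subseteq> C" "C \<subseteq> V" "convex C"
    using locally_convex_nhds_base[OF assms] by blast
  define D where "D = C \<inter> uminus ` C"
  have D: "convex D" "0 \<in> D" and sym: "\<And>x. x \<in> D \<Longrightarrow> - x \<in> D"
    using W unfolding D_def by (auto intro!: convex_Int convex_negations)
  define W' where "W' = W \<inter> uminus -` W"
  have W': "open W'" "0 \<in> W'"
    using W by (auto simp: W'_def intro!: open_Int open_vimage continuous_intros)
  have "W' \<subseteq> D"
    using W(3) unfolding W'_def D_def by (force simp: image_iff)
  have absorbing: "\<exists>t>0. (1 / t) *\<^sub>R x \<in> D" for x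
  proof -
    have "open ((\<lambda>r. r *\<^sub>R x) -` W')"
      by (rule open_vimage[OF W'(1) continuous_on_scaleR_const_right])
    moreover have "0 \<in> (\<lambda>r. r *\<^sub>R x) -` W'" using W'(2) by simp
    ultimately obtain d where d: "0 < d" "\<And>r. dist r 0 < d \<Longrightarrow> r *\<^sub>R x \<in> W'"
      unfolding open_dist by blast
    have "(1 / (2 / d)) *\<^sub>R x \<in> W'" using d(1) by (intro d(2)) auto
    with d(1) \<open>W' \<subseteq> D\<close> show ?thesis by (intro exI[of _ "2 / d"]) auto
  qed
  have sn: "seminorm (gauge_of D)"
    using D sym absorbing by (rule seminorm_gauge_of)
  show thesis
  proof
    show "seminorm (gauge_of D)" by fact
    show "continuous_on UNIV (gauge_of D)"
      using sn W' by (rule continuous_seminorm) (use \<open>W' \<subseteq> D\<close> in \<open>auto intro!: gauge_of_le\<close>)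
    show "x \<in> V" if "gauge_of D x < 1" for x
      using gauge_of_less_imp[OF D that absorbing] W(4) by (auto simp: D_def)
  qed
qed

section \<open>Linear growth of uniformly continuous functions\<close>

text \<open>
  A chaining argument. The seminorm \<open>p\<close> measures steps on which \<open>q \<circ> f\<close> varies by less than \<open>1\<close>,
  and convexity of \<open>U\<close> allows every point \<open>x\<close> of \<open>U\<close> to be reached from \<open>0\<close> inside \<open>U\<close> in at most
  \<open>p x + 1\<close> such steps.
\<close>

lemma uniformly_continuous_on_convex_linear_growth:
  fixes f :: "'e::locally_convex_space \<Rightarrow> 'f::locally_convex_space"
  assumes uc: "uniformly_continuous_on U f" and "convex U" "0 \<in> U"
    and q: "seminorm q" "continuous_on UNIV q"
  obtains p where "seminorm p" "continuous_on UNIV p"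
    "\<And>x. x \<in> U \<Longrightarrow> q (f x) \<le> p x + (q (f 0) + 1)"
proof -
  have "open (q -` {..<1})" using q(2) by (intro open_vimage) auto
  then have "\<forall>\<^sub>F (u, v) in uniformity. q (v - u) < 1"
    unfolding eventually_uniformity_iff_nhds_0
    by (intro exI[of _ "q -` {..<1}"]) (auto simp: seminorm_zero[OF q(1)])
  then have "\<forall>\<^sub>F (x, y) in uniformity. x \<in> U \<longrightarrow> y \<in> U \<longrightarrow> q (f y - f x) < 1"
    using uc unfolding uniformly_continuous_on_uniformity filterlim_iff
    by (auto simp: eventually_inf_principal case_prod_unfold dest!: spec elim!: eventually_mono)
  then obtain V where V: "open V" "0 \<in> V"
    "\<And>x y. \<lbrakk>y - x \<in> V; x \<in> U; y \<in> U\<rbrakk> \<Longrightarrow> q (f y - f x) < 1"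
    unfolding eventually_uniformity_iff_nhds_0 by auto
  obtain p where p: "seminorm p" "continuous_on UNIV p" "\<And>x. p x < 1 \<Longrightarrow> x \<in> V"
    using continuous_seminorm_inside_nhd[OF V(1,2)] by blast
  show thesis
  proof (rule that[OF p(1,2)])
    fix x assume "x \<in> U"
    \<comment> \<open>One more than the integer part, so that \<open>p x / n\<close> is strictly below \<open>1\<close>, even when \<open>p x\<close> is an integer.\<close>
    define n where "n = Suc (nat \<lfloor>p x\<rfloor>)"
    have n: "p x < real n" "real n \<le> p x + 1"
      using seminorm_nonneg[OF p(1), of x] unfolding n_def by linarith+
    have "0 < n" by (simp add: n_def)
    define z where "z k = (real k / real n) *\<^sub>R x" for k
    have z_U: "z k \<in> U" if "k \<le> n" for k
    proof -
      have "(1 - real k / real n) *\<^sub>R 0 + (real k / real n) *\<^sub>R x \<in> U"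
        by (rule convexD[OF \<open>convex U\<close> \<open>0 \<in> U\<close> \<open>x \<in> U\<close>]) (use that \<open>0 < n\<close> in auto)
      then show ?thesis by (simp add: z_def)
    qed
    have step: "z (Suc k) - z k \<in> V" for k
    proof (rule p(3))
      have "z (Suc k) - z k = (1 / real n) *\<^sub>R x"
        by (simp add: z_def scaleR_diff_left[symmetric] diff_divide_distrib[symmetric])
      then have "p (z (Suc k) - z k) = \<bar>1 / real n\<bar> * p x"
        using p(1) unfolding seminorm_def by simp
      then show "p (z (Suc k) - z k) < 1" using n(1) \<open>0 < n\<close> by simp
    qed
    have tri: "q (a + b) \<le> q a + q b" for a b
      using q(1) unfolding seminorm_def by blast
    have "q (f (z k)) \<le> q (f 0) + real k" if "k \<le> n" for k
      using that
    proof (induction k)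
      case 0
      then show ?case by (simp add: z_def)
    next
      case (Suc k)
      have "q (f (z k) + (f (z (Suc k)) - f (z k))) \<le> q (f (z k)) + q (f (z (Suc k)) - f (z k))"
        by (rule tri)
      moreover have "q (f (z (Suc k)) - f (z k)) < 1"
        using Suc.prems by (intro V(3) step z_U) auto
      ultimately show ?case using Suc by simp
    qed
    from this[of n] n(2) \<open>0 < n\<close> show "q (f x) \<le> p x + (q (f 0) + 1)"
      by (simp add: z_def)
  qed
qed

section \<open>Transfer of the growth bound\<close>

theorem lemma4p5:
  fixes star :: "'u \<Rightarrow> 'v" and ext :: "'u list set \<Rightarrow> 'v list set" and \<kappa> :: "'k rel"
    and iR :: "real \<Rightarrow> 'u"
    and iE :: "'e::locally_convex_space \<Rightarrow> 'u"
    and iF :: "'f::locally_convex_space \<Rightarrow> 'u"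
    and U :: "'e set" and f :: "'e \<Rightarrow> 'f"
  assumes "nonstandard_extension star ext"
    and "Card_order \<kappa>" and "natLeq <o \<kappa>" and "saturated \<kappa> ext"
    and "inj iR" and "inj iE" and "inj iF"
    and "open U" and "0 \<in> U"
    and "uniformly_continuous_on U f" and "convex U"
  shows "finite_function star ext iR iE iF U f"
  unfolding finite_function_def
proof (rule image_subsetI)
  note ne = assms(1) and inj = assms(5-7)
  fix v assume v: "v \<in> ext_set ext iE U \<inter> finite_points star ext iR iE"
  then have v_U: "v \<in> ext_set ext iE U" and v_E: "v \<in> ext_set ext iE UNIV"
    by (auto simp: finite_points_def)
  let ?w = "ext_fun ext iE iF U f v"
  have w_in: "?w \<in> ext_set ext iF B \<longleftrightarrow> v \<in> ext_set ext iE {a \<in> U. f a \<in> B}" for B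
    by (rule ext_fun_in_ext_set_iff[OF ne inj(2,3) v_U])
  have w_F: "?w \<in> ext_set ext iF UNIV"
    using w_in[of UNIV] v_U by simp
  have "finite_hyperreal star ext iR (ext_fun ext iF iR UNIV q ?w)"
    if q: "seminorm q" "continuous_on UNIV q" for q
  proof -
    obtain p where p: "seminorm p" "continuous_on UNIV p"
      and le: "\<And>x. x \<in> U \<Longrightarrow> q (f x) \<le> p x + (q (f 0) + 1)"
      using uniformly_continuous_on_convex_linear_growth[OF assms(10,11,9) q] by blast
    obtain n :: nat where n: "v \<in> ext_set ext iE {a. \<bar>p a\<bar> \<le> real n}"
      using v p finite_hyperreal_ext_fun_iff[OF ne inj(2,1) v_E, of p]
      by (auto simp: finite_points_def)
    obtain m :: nat where m: "real n + (q (f 0) + 1) \<le> real m"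
      using real_arch_simple by blast
    have "U \<inter> {a. \<bar>p a\<bar> \<le> real n} \<subseteq> {a \<in> U. f a \<in> {b. \<bar>q b\<bar> \<le> real m}}"
    proof clarsimp
      fix a assume "a \<in> U" "\<bar>p a\<bar> \<le> real n"
      then show "\<bar>q (f a)\<bar> \<le> real m"
        using le[of a] m seminorm_nonneg[OF q(1), of "f a"] by linarith
    qed
    then have "v \<in> ext_set ext iE {a \<in> U. f a \<in> {b. \<bar>q b\<bar> \<le> real m}}"
      using ext_set_mono[OF ne] ext_set_Int[OF ne inj(2)] v_U n by blast
    then show ?thesis
      unfolding finite_hyperreal_ext_fun_iff[OF ne inj(3,1) w_F] w_in[symmetric] by blast
  qed
  with w_F show "?w \<in> finite_points star ext iR iF"
    by (simp add: finite_points_def)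
qed

end
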